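(* Let $G$ be an undirected loopless quantum graph. A projective subset $X\sqsubseteq V(G)$ is an independent set of $G$, i.e. $X\times X$ and $E(G)$ are disjoint, if and only if it is a clique of the complement graph $G^c$, i.e. $X\times X\sqsubseteq E(G^c)\cup\Delta$.
   Context: All Hilbert spaces are finite-dimensional; "projector" means orthogonal projector. Quantum sets. A quantum set is a special symmetric $\dagger$-Frobenius monoid in finite-dimensional Hilbert spaces; equivalently a finite-dimensional C*-algebra, up to isomorphism $X=\bigoplus_{i=1}^k M_{n_i}$ with the usual product, unit $1$ and involution, and inner product $\langle a,b\rangle=\sum_i n_i\mathrm{Tr}(a_i^*b_i)$, for which the multiplication $m:X\otimes X\to X$ satisfies $mm^\dagger=\mathrm{id}_X$. It acts block-diagonally on $H=\bigoplus_i\mathbb{C}^{n_i}$, so $X\subseteq B(H)$; $X'$ denotes the commutant in $B(H)$. Projective subsets. A projective subset $Y\sqsubseteq X$ is given by a projector $\widehat Y:X\to X$ with $\widehat Y(ab)=\widehat Y(a)b$ for all $a,b\in X$. These correspond bijectively to projections $\widetilde Y=\widehat Y(1)\in X$, via $\widehat Y(a)=\widetilde Ya$; $\widetilde Y$ is also viewed as a projector on $H$. For $Y,Z\sqsubseteq X$: the complement $Y^c$ has projection $1-\widetilde Y$; the intersection $Y\cap Z$ has as its projection the projector onto $\mathrm{img}\,\widetilde Y\cap\mathrm{img}\,\widetilde Z$; the union $Y\cup Z$ that onto $\mathrm{span}(\mathrm{img}\,\widetilde Y\cup\mathrm{img}\,\widetilde Z)$; $Y\setminus Z=Y\cap Z^c$;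 $Y\sqsubseteq Z$ means $\mathrm{img}\,\widetilde Y\subseteq\mathrm{img}\,\widetilde Z$; $Y,Z$ are disjoint if $\mathrm{img}\,\widetilde Y\perp\mathrm{img}\,\widetilde Z$. Cartesian products. For $V\subseteq B(H)$, the quantum set $V^{op}\otimes V$ acts on $H^*\otimes H\cong B(H)$ (identify $\langle u|\otimes|v\rangle$ with $|v\rangle\langle u|$) by $(a\otimes b)\cdot x=bxa$; thus projections in $V^{op}\otimes V$ have images in $B(H)$, which carries the Hilbert–Schmidt inner product. For $Y,Z\sqsubseteq V$, $Y\times Z\sqsubseteq V^{op}\otimes V$ is the projective subset whose projection acts on $B(H)$ as $x\mapsto\widetilde Zx\widetilde Y$. The diagonal relation $\Delta\sqsubseteq V^{op}\otimes V$ is the projective subset with $\mathrm{img}\,\widetilde\Delta=V'\subseteq B(H)$. Quantum graphs. A quantum graph $G$ is a quantum set $V=V(G)$ with an adjacency operator $A_G:V\to V$ satisfying $m(A_G\otimes A_G)m^\dagger=A_G$ and $A_G(x^* )=A_G(x)^*$. Equivalently, it is given by its edge relation $E(G)\sqsubseteq V^{op}\otimes V$, i.e. a projector $\widehat{E(G)}$ on $V\otimes V$ with $\widehat{E(G)}(ax\otimes yb)=(a\otimes 1)\widehat{E(G)}(x\otimes y)(1\otimes b)$, related by $\widehat{E(G)}=(\mathrm{id}\otimes m)(\mathrm{id}\otimes A_G\otimes\mathrm{id})(m^\dagger\otimes\mathrm{id})$. $G$ is undirected if $A_G=A_G^\dagger$ and loopless if $m(A_G\otimes\mathrm{id})m^\dagger=0$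 (equivalently $E(G)$ and $\Delta$ are disjoint). The complement $G^c$ has $V(G^c)=V(G)$ and $E(G^c)=E(G)^c\setminus\Delta$. A clique of a quantum graph $K$ is a projective subset $X\sqsubseteq V(K)$ with $X\times X\sqsubseteq E(K^\circ)$, where $E(K^\circ)=E(K)\cup\Delta$. *)

theory Defs
  imports "HOL-Analysis.Analysis"
begin

section \<open>Quantum sets\<close>

text \<open>
  A map b from a finite type 'h to labels encodes the quantum set given by the direct sum, over
  the labels c in the range of b, of the full matrix algebras of size n(c) = card (b -` {c}).  It
  is realised as the algebra of block-diagonal operators on H = complex^'h, the direct sum of
  the spaces C^n(c).  All linear maps between quantum sets are HOL functions whose values outside
  the algebra are irrelevant.
\<close>

type_synonym 'h opr = "complex^'h^'h"

definition qalg :: "('h::finite \<Rightarrow> 'k) \<Rightarrow> 'h opr set" where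
  "qalg b = {a. \<forall>i j. b i \<noteq> b j \<longrightarrow> a $ i $ j = 0}"

definition commutant :: "('h::finite \<Rightarrow> 'k) \<Rightarrow> 'h opr set" where
  "commutant b = {x. \<forall>a\<in>qalg b. x ** a = a ** x}"

definition mstar :: "'h::finite opr \<Rightarrow> 'h opr" where
  "mstar a = map_matrix cnj (transpose a)"

definition cscale :: "complex \<Rightarrow> 'h::finite opr \<Rightarrow> 'h opr" where
  "cscale c a = map_matrix ((*) c) a"

definition block_dim :: "('h::finite \<Rightarrow> 'k) \<Rightarrow> 'h \<Rightarrow> complex" where
  "block_dim b i = of_nat (card (b -` {b i}))"

text \<open>
  The sum over c of n(c) Tr(x_c^* y_c); each diagonal entry of x^* y is weighted with the size of
  the block containing it.
\<close>

definition qinner :: "('h::finite \<Rightarrow> 'k) \<Rightarrow> 'h opr \<Rightarrow> 'h opr \<Rightarrow> complex" where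
  "qinner b x y = (\<Sum>i\<in>UNIV. block_dim b i * (mstar x ** y) $ i $ i)"

definition linear_between :: "'h::finite opr set \<Rightarrow> 'g::finite opr set \<Rightarrow> ('h opr \<Rightarrow> 'g opr) \<Rightarrow> bool" where
  "linear_between X Y f \<longleftrightarrow>
     (\<forall>x\<in>X. f x \<in> Y) \<and>
     (\<forall>x\<in>X. \<forall>y\<in>X. f (x + y) = f x + f y) \<and>
     (\<forall>c. \<forall>x\<in>X. f (cscale c x) = cscale c (f x))"

text \<open>The adjoint of a linear map from \<open>qalg b\<close> to \<open>qalg d\<close>.\<close>

definition qadjoint ::
  "('h::finite \<Rightarrow> 'k) \<Rightarrow> ('g::finite \<Rightarrow> 'l) \<Rightarrow> ('h opr \<Rightarrow> 'g opr) \<Rightarrow> 'g opr \<Rightarrow> 'h opr" where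
  "qadjoint b d f y =
     (THE x. x \<in> qalg b \<and> (\<forall>z\<in>qalg b. qinner b x z = qinner d y (f z)))"


section \<open>Tensor products\<close>

text \<open>
  The tensor product of the quantum sets b and d is \<open>map_prod b d\<close>, acting on the tensor product
  complex^('h \<times> 'g) of the underlying spaces, with \<open>kron x y\<close> in the role of the elementary tensor.
\<close>

definition kron :: "'h::finite opr \<Rightarrow> 'g::finite opr \<Rightarrow> ('h \<times> 'g) opr" where
  "kron x y = (\<chi> p q. x $ fst p $ fst q * y $ snd p $ snd q)"

definition munit :: "'h::finite \<Rightarrow> 'h \<Rightarrow> 'h opr" where
  "munit i j = (\<chi> r s. if r = i \<and> s = j then 1 else 0)"

text \<open>
  The linear map sending \<open>kron x y\<close> to \<open>kron (f x) (g y)\<close>, by expansion in matrix units.  On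
  \<open>qalg (map_prod b d)\<close> the units outside \<open>qalg b\<close> and \<open>qalg d\<close> have coefficient 0.
\<close>

definition tensor_map ::
  "('h::finite opr \<Rightarrow> 'h1::finite opr) \<Rightarrow> ('g::finite opr \<Rightarrow> 'g1::finite opr)
     \<Rightarrow> ('h \<times> 'g) opr \<Rightarrow> ('h1 \<times> 'g1) opr" where
  "tensor_map f g t =
     (\<Sum>p\<in>UNIV. \<Sum>q\<in>UNIV. cscale (t $ p $ q)
        (kron (f (munit (fst p) (fst q))) (g (munit (snd p) (snd q)))))"

definition tensor_assoc :: "(('h::finite \<times> 'g::finite) \<times> 'l::finite) opr \<Rightarrow> ('h \<times> ('g \<times> 'l)) opr" where
  "tensor_assoc t =
     (\<chi> p q. t $ ((fst p, fst (snd p)), snd (snd p)) $ ((fst q, fst (snd q)), snd (snd q)))"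

definition qmult :: "('h::finite \<times> 'h) opr \<Rightarrow> 'h opr" where
  "qmult t = (\<chi> i k. \<Sum>j\<in>UNIV. t $ (i, j) $ (j, k))"

lemma qmult_kron: "qmult (kron x y) = x ** y"
  by (simp add: qmult_def kron_def matrix_matrix_mult_def)

definition qcomult :: "('h::finite \<Rightarrow> 'k) \<Rightarrow> 'h opr \<Rightarrow> ('h \<times> 'h) opr" where
  "qcomult b = qadjoint (map_prod b b) b qmult"


section \<open>Projective subsets\<close>

text \<open>A projective subset is represented by the map \<open>Y\<close> on the algebra; its projection is \<open>Y (mat 1)\<close>.\<close>

definition projective_subset :: "('h::finite \<Rightarrow> 'k) \<Rightarrow> ('h opr \<Rightarrow> 'h opr) \<Rightarrow> bool" where
  "projective_subset b Y \<longleftrightarrow>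
     linear_between (qalg b) (qalg b) Y \<and>
     (\<forall>x\<in>qalg b. Y (Y x) = Y x) \<and>
     (\<forall>x\<in>qalg b. \<forall>y\<in>qalg b. qinner b (Y x) y = qinner b x (Y y)) \<and>
     (\<forall>x\<in>qalg b. \<forall>y\<in>qalg b. Y (x ** y) = Y x ** y)"

definition projection :: "('h::finite opr \<Rightarrow> 'h opr) \<Rightarrow> 'h opr" where
  "projection Y = Y (mat 1)"

definition of_projection :: "'h::finite opr \<Rightarrow> 'h opr \<Rightarrow> 'h opr" where
  "of_projection P = (\<lambda>x. P ** x)"

definition img :: "('h::finite opr \<Rightarrow> 'h opr) \<Rightarrow> (complex^'h) set" where
  "img Y = range ((*v) (projection Y))"

definition cinner :: "complex^'h::finite \<Rightarrow> complex^'h \<Rightarrow> complex" where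
  "cinner u v = (\<Sum>i\<in>UNIV. cnj (u $ i) * v $ i)"

definition projector_onto :: "(complex^'h::finite) set \<Rightarrow> 'h opr" where
  "projector_onto S = (THE P. P ** P = P \<and> mstar P = P \<and> range ((*v) P) = S)"

definition ps_compl :: "('h::finite opr \<Rightarrow> 'h opr) \<Rightarrow> 'h opr \<Rightarrow> 'h opr" where
  "ps_compl Y = of_projection (mat 1 - projection Y)"

definition ps_inter ::
  "('h::finite opr \<Rightarrow> 'h opr) \<Rightarrow> ('h opr \<Rightarrow> 'h opr) \<Rightarrow> 'h opr \<Rightarrow> 'h opr" where
  "ps_inter Y Z = of_projection (projector_onto (img Y \<inter> img Z))"

definition ps_union ::
  "('h::finite opr \<Rightarrow> 'h opr) \<Rightarrow> ('h opr \<Rightarrow> 'h opr) \<Rightarrow> 'h opr \<Rightarrow> 'h opr" where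
  "ps_union Y Z = of_projection (projector_onto (vec.span (img Y \<union> img Z)))"

definition ps_diff ::
  "('h::finite opr \<Rightarrow> 'h opr) \<Rightarrow> ('h opr \<Rightarrow> 'h opr) \<Rightarrow> 'h opr \<Rightarrow> 'h opr" where
  "ps_diff Y Z = ps_inter Y (ps_compl Z)"

definition ps_le :: "('h::finite opr \<Rightarrow> 'h opr) \<Rightarrow> ('h opr \<Rightarrow> 'h opr) \<Rightarrow> bool" where
  "ps_le Y Z \<longleftrightarrow> img Y \<subseteq> img Z"

definition ps_disjoint :: "('h::finite opr \<Rightarrow> 'h opr) \<Rightarrow> ('h opr \<Rightarrow> 'h opr) \<Rightarrow> bool" where
  "ps_disjoint Y Z \<longleftrightarrow> (\<forall>u\<in>img Y. \<forall>v\<in>img Z. cinner u v = 0)"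


section \<open>Cartesian products and the diagonal\<close>

text \<open>
  \<open>vec_of_op\<close> identifies |j><i| in B(H) with <i| \<otimes> |j> in \<open>H\<^sup>* \<otimes> H\<close>, the latter being complex^('h \<times> 'h).
  An element a of the opposite algebra acts on the dual space by the transposed matrix, so the
  opposite of b is again the quantum set b, and the element a \<otimes> c of \<open>V\<^sup>o\<^sup>p \<otimes> V\<close> is realised as
  \<open>kron (transpose a) c\<close> in \<open>qalg (map_prod b b)\<close>; see \<open>op_tensor_action\<close>.
\<close>

definition vec_of_op :: "'h::finite opr \<Rightarrow> complex^('h \<times> 'h)" where
  "vec_of_op x = (\<chi> p. x $ snd p $ fst p)"

definition op_of_vec :: "complex^('h::finite \<times> 'h) \<Rightarrow> 'h opr" where
  "op_of_vec v = (\<chi> i j. v $ (j, i))"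

lemma sum_UNIV_prod:
  "(\<Sum>p\<in>UNIV. f p) = (\<Sum>i\<in>UNIV. \<Sum>j\<in>UNIV. f (i::'a::finite, j::'b::finite))"
  by (simp add: UNIV_Times_UNIV[symmetric] sum.cartesian_product del: UNIV_Times_UNIV)

lemma op_tensor_action:
  "kron (transpose a) c *v vec_of_op x = vec_of_op (c ** x ** a)"
  by (simp add: kron_def vec_of_op_def matrix_vector_mult_def matrix_matrix_mult_def
      transpose_def vec_eq_iff sum_UNIV_prod sum_distrib_left sum_distrib_right mult_ac)

text \<open>Transposition of the first leg, exchanging a \<otimes> c in \<open>V \<otimes> V\<close> and its realisation in \<open>V\<^sup>o\<^sup>p \<otimes> V\<close>.\<close>

definition ptranspose :: "('h::finite \<times> 'h) opr \<Rightarrow> ('h \<times> 'h) opr" where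
  "ptranspose t = (\<chi> p q. t $ (fst q, snd p) $ (fst p, snd q))"

lemma ptranspose_kron: "ptranspose (kron a c) = kron (transpose a) c"
  by (simp add: ptranspose_def kron_def transpose_def)

definition ps_times ::
  "('h::finite opr \<Rightarrow> 'h opr) \<Rightarrow> ('h opr \<Rightarrow> 'h opr) \<Rightarrow> ('h \<times> 'h) opr \<Rightarrow> ('h \<times> 'h) opr" where
  "ps_times Y Z = of_projection
     (matrix (\<lambda>v. vec_of_op (projection Z ** op_of_vec v ** projection Y)))"

definition diagonal :: "('h::finite \<Rightarrow> 'k) \<Rightarrow> ('h \<times> 'h) opr \<Rightarrow> ('h \<times> 'h) opr" where
  "diagonal b = of_projection (projector_onto (vec_of_op ` commutant b))"


section \<open>Quantum graphs\<close>

record ('h, 'k) qgraph =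
  verts :: "'h \<Rightarrow> 'k"
  adj :: "'h opr \<Rightarrow> 'h opr"

definition quantum_graph :: "('h::finite, 'k) qgraph \<Rightarrow> bool" where
  "quantum_graph G \<longleftrightarrow>
     linear_between (qalg (verts G)) (qalg (verts G)) (adj G) \<and>
     (\<forall>x\<in>qalg (verts G).
        qmult (tensor_map (adj G) (adj G) (qcomult (verts G) x)) = adj G x) \<and>
     (\<forall>x\<in>qalg (verts G). adj G (mstar x) = mstar (adj G x))"

definition undirected :: "('h::finite, 'k) qgraph \<Rightarrow> bool" where
  "undirected G \<longleftrightarrow>
     (\<forall>x\<in>qalg (verts G). adj G x = qadjoint (verts G) (verts G) (adj G) x)"

definition loopless :: "('h::finite, 'k) qgraph \<Rightarrow> bool" where
  "loopless G \<longleftrightarrow>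
     (\<forall>x\<in>qalg (verts G). qmult (tensor_map (adj G) id (qcomult (verts G) x)) = 0)"

text \<open>The projector on \<open>V \<otimes> V\<close> belonging to the edge relation, (id \<otimes> m)(id \<otimes> A \<otimes> id)(m* \<otimes> id).\<close>

definition edge_op :: "('h::finite, 'k) qgraph \<Rightarrow> ('h \<times> 'h) opr \<Rightarrow> ('h \<times> 'h) opr" where
  "edge_op G t =
     tensor_map id qmult (tensor_assoc
       (tensor_map (tensor_map id (adj G)) id
         (tensor_map (qcomult (verts G)) id t)))"

text \<open>The edge relation as a projective subset of \<open>V\<^sup>o\<^sup>p \<otimes> V\<close>.\<close>

definition edges :: "('h::finite, 'k) qgraph \<Rightarrow> ('h \<times> 'h) opr \<Rightarrow> ('h \<times> 'h) opr" where
  "edges G t = ptranspose (edge_op G (ptranspose t))"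

text \<open>
  The adjacency operator of the graph with edge relation E is recovered as
  A(x) = (\<epsilon> \<otimes> id)(E(x \<otimes> 1)), where \<epsilon>(y) = <1, y> is the counit and E is regarded as a map on
  \<open>V \<otimes> V\<close>.
\<close>

definition counit_id :: "('h::finite \<Rightarrow> 'k) \<Rightarrow> ('h \<times> 'h) opr \<Rightarrow> 'h opr" where
  "counit_id b t =
     (\<Sum>p\<in>UNIV. \<Sum>q\<in>UNIV. cscale (t $ p $ q * qinner b (mat 1) (munit (fst p) (fst q)))
        (munit (snd p) (snd q)))"

definition graph_of_edges ::
  "('h::finite \<Rightarrow> 'k) \<Rightarrow> (('h \<times> 'h) opr \<Rightarrow> ('h \<times> 'h) opr) \<Rightarrow> ('h, 'k) qgraph" where
  "graph_of_edges b E =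
     \<lparr>verts = b, adj = (\<lambda>x. counit_id b (ptranspose (E (ptranspose (kron x (mat 1))))))\<rparr>"

text \<open>
  Every projective subset of \<open>V\<^sup>o\<^sup>p \<otimes> V\<close> is the edge relation of its \<open>graph_of_edges\<close>; this is
  \<open>edges_graph_of_edges\<close> below.
\<close>

lemma card_block_nonzero: "(of_nat (card (b -` {b (i::'a::finite)})) :: complex) \<noteq> 0"
  by (auto simp: card_eq_0_iff)

lemma sum_if_const: "(\<Sum>x\<in>A. if P then f x else 0) = (if P then sum f A else 0)" by simp

lemma munit_nth: "munit p p' $ i $ i' = (if p = i then if p' = i' then 1 else 0 else 0)"
  by (auto simp: munit_def)

lemma mult_if_zero: "x * (if P then a else 0) = (if P then x * a else (0::complex))"
    "(if P then a else 0) * x = (if P then a * x else (0::complex))" by auto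

lemma tensor_map_nth: "tensor_map f g t $ (i,j) $ (i',j') =
  (\<Sum>p\<in>UNIV. \<Sum>q\<in>UNIV. \<Sum>p'\<in>UNIV. \<Sum>q'\<in>UNIV. t $ (p,q) $ (p',q') * (f (munit p p') $ i $ i' * g (munit q q') $ j $ j'))"
  by (simp add: tensor_map_def sum_UNIV_prod cscale_def kron_def)

lemma tensor_map_id_left_nth: "tensor_map id g t $ (i,j) $ (i',j') =
  (\<Sum>q\<in>UNIV. \<Sum>q'\<in>UNIV. t $ (i,q) $ (i',q') * g (munit q q') $ j $ j')"
  unfolding tensor_map_nth id_apply munit_nth mult_if_zero sum_if_const by simp

lemma tensor_map_id_right_nth: "tensor_map f id t $ (i,j) $ (i',j') =
  (\<Sum>q\<in>UNIV. \<Sum>q'\<in>UNIV. t $ (q,j) $ (q',j') * f (munit q q') $ i $ i')"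
  unfolding tensor_map_nth id_apply munit_nth mult_if_zero sum_if_const by simp

lemma block_dim_nonzero: "block_dim b i \<noteq> 0" using card_block_nonzero by (auto simp: block_dim_def)

lemma qinner_nth: "qinner b x y = (\<Sum>i\<in>UNIV. \<Sum>k\<in>UNIV. block_dim b i * (cnj (x$k$i) * y$k$i))"
  by (simp add: qinner_def block_dim_def mstar_def matrix_matrix_mult_def transpose_def sum_distrib_left)

lemma block_dim_prod: "block_dim (map_prod b d) (i,j) = block_dim b i * block_dim d j"
proof -
  have "map_prod b d -` {(b i, d j)} = (b -` {b i}) \<times> (d -` {d j})" by auto
  then show ?thesis by (simp add: block_dim_def card_cartesian_product)
qed

lemma qalg_map_prod_iff: "t \<in> qalg (map_prod b d) \<longleftrightarrow> (\<forall>i j i' j'. \<not> (b i = b i' \<and> d j = d j') \<longrightarrow> t $ (i,j) $ (i',j') = 0)"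
  by (auto simp: qalg_def)

lemma qinner_nondeg: assumes "x \<in> qalg b" "y \<in> qalg b" "\<forall>z\<in>qalg b. qinner b x z = qinner b y z" shows "x = y"
proof -
  have "x $ i $ j = y $ i $ j" for i j
  proof (cases "b i = b j")
    case True
    then have "munit i j \<in> qalg b" by (auto simp: qalg_def munit_def)
    moreover have "qinner b w (munit i j) = block_dim b j * cnj (w $ i $ j)" for w
      unfolding qinner_nth munit_nth mult_if_zero sum_if_const
      by (simp add: sum.delta' mult_if_zero sum_if_const if_distrib[of "\<lambda>x. _ * x"] cong: if_cong)
    ultimately have "block_dim b j * cnj (x $ i $ j) = block_dim b j * cnj (y $ i $ j)" using assms(3) by metis
    then show ?thesis by (simp add: block_dim_nonzero)
  next
    case False then show ?thesis using assms by (auto simp: qalg_def)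
  qed
  then show ?thesis by (simp add: vec_eq_iff)
qed

lemma qcomult_nth: assumes "x \<in> qalg b"
  shows "qcomult b x = (\<chi> p q. if fst q = snd p \<and> b (fst p) = b (snd p) then x $ fst p $ snd q / block_dim b (fst p) else 0)" (is "_ = ?w")
proof -
  have w: "?w \<in> qalg (map_prod b b)" unfolding qalg_map_prod_iff using assms by (auto simp: qalg_def)
  have i: "qinner (map_prod b b) ?w z = qinner b x (qmult z)" if z: "z \<in> qalg (map_prod b b)" for z
  proof -
    have "qinner (map_prod b b) ?w z = (\<Sum>i\<in>UNIV. \<Sum>j\<in>UNIV. \<Sum>k\<in>UNIV. 
         \<Sum>l\<in>UNIV. block_dim b i * block_dim b j * (cnj (if i = l \<and> b k = b l then x $ k $ j / block_dim b k else 0) * z $ (k, l) $ (i, j)))"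
      unfolding qinner_nth sum_UNIV_prod block_dim_prod vec_lambda_beta fst_conv snd_conv ..
    also have "\<dots> = (\<Sum>i\<in>UNIV. \<Sum>j\<in>UNIV. \<Sum>k\<in>UNIV. 
         \<Sum>l\<in>UNIV. if l = i then block_dim b j * (cnj (x $ k $ j) * z $ (k, l) $ (i, j)) else 0)"
    proof (intro sum.cong refl)
      fix i j k l 
      have "cnj (block_dim b k) = block_dim b k" by (simp add: block_dim_def)
      moreover have "block_dim b k = block_dim b i" if "b k = b i" using that by (simp add: block_dim_def)
      moreover have "z $ (k, i) $ (i, j) = 0" if "b k \<noteq> b i" using z that by (auto simp: qalg_map_prod_iff)
      ultimately show "block_dim b i * block_dim b j * (cnj (if i = l \<and> b k = b l then x $ k $ j / block_dim b k else 0) * z $ (k, l) $ (i, j)) = (if l = i then block_dim b j * (cnj (x $ k $ j) * z $ (k, l) $ (i, j)) else 0)"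
        using block_dim_nonzero[of b i] by (cases "b k = b i") (auto simp: field_simps)
    qed
    also have "\<dots> = (\<Sum>i\<in>UNIV. \<Sum>j\<in>UNIV. \<Sum>k\<in>UNIV. block_dim b j * (cnj (x $ k $ j) * z $ (k, i) $ (i, j)))" by simp
    also have "\<dots> = (\<Sum>j\<in>UNIV. \<Sum>k\<in>UNIV. \<Sum>i\<in>UNIV. block_dim b j * (cnj (x $ k $ j) * z $ (k, i) $ (i, j)))"
      by (subst sum.swap) (intro sum.cong refl sum.swap)
    also have "\<dots> = qinner b x (qmult z)" 
      unfolding qinner_nth by (simp add: qmult_def sum_distrib_left)
    finally show ?thesis .
  qed
  show ?thesis unfolding qcomult_def qadjoint_def
    by (rule the_equality) (fastforce simp: w i, metis (no_types, lifting) w i qinner_nondeg)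
qed

lemma qmult_nth: "qmult t $ i $ k = (\<Sum>j\<in>UNIV. t $ (i, j) $ (j, k))" by (simp add: qmult_def)

lemma edge_op_nth:
  assumes t: "t \<in> qalg (map_prod (verts G) (verts G))"
  shows "edge_op G t $ (i,j) $ (i',j') = (\<Sum>m\<in>UNIV. \<Sum>s\<in>UNIV.
     (if verts G i = verts G i' then t $ (i,m) $ (s,j') * adj G (munit i' s) $ j $ m / block_dim (verts G) i else 0))"
proof -
  let ?b = "verts G"
  define T1 where "T1 = tensor_map (qcomult ?b) id t"
  have T1: "T1 $ ((i,s),m) $ ((i',s'),j') = (if i' = s \<and> ?b i = ?b s then t $ (i,m) $ (s',j') / block_dim ?b i else 0)" for i s m i' s' j'
  proof -
    have "T1 $ ((i,s),m) $ ((i',s'),j') = (\<Sum>q\<in>UNIV. \<Sum>q'\<in>UNIV. if q = i then if q' = s' then if i' = s \<and> ?b i = ?b s then t $ (q, m) $ (q', j') / block_dim ?b i else 0 else 0 else 0)"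
      unfolding T1_def tensor_map_id_right_nth
    proof (intro sum.cong refl)
      fix q q'
      show "t $ (q, m) $ (q', j') * qcomult ?b (munit q q') $ (i, s) $ (i', s') = (if q = i then if q' = s' then if i' = s \<and> ?b i = ?b s then t $ (q, m) $ (q', j') / block_dim ?b i else 0 else 0 else 0)"
      proof (cases "?b q = ?b q'")
        case True
        then have "munit q q' \<in> qalg ?b" by (auto simp: qalg_def munit_def)
        from qcomult_nth[OF this] show ?thesis by (simp add: munit_nth)
      next
        case False
        then have "t $ (q, m) $ (q', j') = 0" using t by (auto simp: qalg_map_prod_iff)
        then show ?thesis by auto
      qed
    qed
    also have "\<dots> = (if i' = s \<and> ?b i = ?b s then t $ (i,m) $ (s',j') / block_dim ?b i else 0)"
      unfolding sum_if_const by simp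
    finally show ?thesis .
  qed
  define T2 where "T2 = tensor_map (tensor_map id (adj G)) id T1"
  have T2: "T2 $ ((i,j),m) $ ((i',m'),j') = (\<Sum>s\<in>UNIV. \<Sum>s'\<in>UNIV. T1 $ ((i,s),m) $ ((i',s'),j') * adj G (munit s s') $ j $ m')" for i j m i' m' j'
  proof -
    have e: "tensor_map id (adj G) (munit (p,s) (p',s')) $ (i,j) $ (i',m') = (if p = i then if p' = i' then adj G (munit s s') $ j $ m' else 0 else 0)" for p s p' s'
    proof -
      have m2: "munit (p, s) (p', s') $ (i, q) $ (i', q') = (if q = s then if q' = s' then if p = i then if p' = i' then 1 else 0 else 0 else 0 else 0)" for q q'
        by (auto simp: munit_def)
      show ?thesis unfolding tensor_map_id_left_nth m2 mult_if_zero sum_if_const by simp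
    qed
    show ?thesis unfolding T2_def tensor_map_id_right_nth sum_UNIV_prod e mult_if_zero sum_if_const by simp
  qed
  have mm: "qmult (munit (q,r) (q',r')) $ j $ j' = (if q = j then if r = q' then if r' = j' then 1 else 0 else 0 else 0)" for q r q' r'
  proof -
      have m2: "munit (q, r) (q', r') $ (j, m) $ (m, j') = (if m = r then if q = j then if r = q' then if r' = j' then 1 else 0 else 0 else 0 else 0)" for m
        by (auto simp: munit_def)
    show ?thesis unfolding qmult_nth m2 by simp
  qed
  have "edge_op G t $ (i,j) $ (i',j') = (\<Sum>m\<in>UNIV. T2 $ ((i,j),m) $ ((i',m),j'))"
    unfolding edge_op_def T1_def[symmetric] T2_def[symmetric] tensor_map_id_left_nth sum_UNIV_prod mm mult_if_zero sum_if_const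
    by (simp add: tensor_assoc_def)
  also have "\<dots> = (\<Sum>m\<in>UNIV. \<Sum>s\<in>UNIV. 
    (if ?b i = ?b i' then t $ (i,m) $ (s,j') * adj G (munit i' s) $ j $ m / block_dim ?b i else 0))"
  proof (rule sum.cong[OF refl])
    fix m
    have "T2 $ ((i,j),m) $ ((i',m),j') = (\<Sum>s\<in>UNIV. \<Sum>s'\<in>UNIV. if s = i' then if ?b i = ?b s then t $ (i,m) $ (s',j') * adj G (munit s s') $ j $ m / block_dim ?b i else 0 else 0)"
      unfolding T2 T1 by (intro sum.cong refl) auto
    then show "T2 $ ((i,j),m) $ ((i',m),j') = (\<Sum>s\<in>UNIV. 
    (if ?b i = ?b i' then t $ (i,m) $ (s,j') * adj G (munit i' s) $ j $ m / block_dim ?b i else 0))"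
      unfolding sum_if_const by simp
  qed
  finally show ?thesis .
qed

lemma counit_id_nth: "counit_id b t $ j $ j' = (\<Sum>i\<in>UNIV. block_dim b i * t $ (i,j) $ (i,j'))"
proof -
  have e: "qinner b (mat 1) (munit i i') = (if i' = i then block_dim b i else 0)" for i i'
  proof -
    have "qinner b (mat 1) (munit i i') = (\<Sum>a\<in>UNIV. \<Sum>c\<in>UNIV. if c = a then if i = c then if i' = a then block_dim b i else 0 else 0 else 0)"
      unfolding qinner_nth by (intro sum.cong refl) (auto simp: mat_def munit_def)
    then show ?thesis by (simp add: )
  qed
  show ?thesis unfolding counit_id_def sum_UNIV_prod
    by (simp add: cscale_def munit_nth e mult_if_zero sum_if_const sum.delta mult.commute)
qed

lemma ptranspose_nth: "ptranspose t $ (i,j) $ (i',j') = t $ (i',j) $ (i,j')" by (simp add: ptranspose_def)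

lemma edges_graph_of_edges:
  assumes E: "projective_subset (map_prod b b) E" and t: "t \<in> qalg (map_prod b b)"
  shows "edges (graph_of_edges b E) t = E t"
proof -
  define P where "P = E (mat 1)"
  have one: "mat 1 \<in> qalg (map_prod b b)" by (auto simp: qalg_def mat_def)
  have EP: "E t = P ** t" if "t \<in> qalg (map_prod b b)" for t
    using E one that unfolding projective_subset_def P_def by (metis matrix_mul_lid)
  have Pq: "P \<in> qalg (map_prod b b)" using E one unfolding P_def projective_subset_def linear_between_def by auto
  have A: "adj (graph_of_edges b E) (munit i s) $ j $ m = block_dim b i * P $ (i,j) $ (s,m)" if bis: "b i = b s" for i s j m
  proof -
    have "ptranspose (kron (munit i s) (mat 1)) \<in> qalg (map_prod b b)" 
      unfolding qalg_map_prod_iff ptranspose_nth using bis by (auto simp: kron_def munit_def mat_def)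
    note e = EP[OF this]
    have k: "ptranspose (kron (munit i s) (mat 1)) $ (a,c) $ (a',c') = (if c' = c then if a = s then if a' = i then 1 else 0 else 0 else 0)" for a c a' c'
      by (auto simp: ptranspose_nth kron_def munit_def mat_def)
    have "ptranspose (P ** ptranspose (kron (munit i s) (mat 1))) $ (a,j) $ (a,m) = (if a = i then P $ (a,j) $ (s,m) else 0)" for a
      unfolding ptranspose_nth matrix_matrix_mult_def 
      by (simp add: sum_UNIV_prod k mult_if_zero sum_if_const cong: if_cong)
    then show ?thesis unfolding graph_of_edges_def by (simp add: counit_id_nth e mult_if_zero)
  qed
  have pt: "ptranspose t \<in> qalg (map_prod (verts (graph_of_edges b E)) (verts (graph_of_edges b E)))"
    using t unfolding qalg_map_prod_iff ptranspose_nth graph_of_edges_def by auto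
  have v: "verts (graph_of_edges b E) = b" by (simp add: graph_of_edges_def)
  have "edges (graph_of_edges b E) t $ (i,j) $ (i',j') = (P ** t) $ (i,j) $ (i',j')" for i j i' j'
  proof -
    have "edges (graph_of_edges b E) t $ (i,j) $ (i',j') = (\<Sum>m\<in>UNIV. \<Sum>s\<in>UNIV. P $ (i,j) $ (s,m) * t $ (s,m) $ (i',j'))"
      unfolding edges_def ptranspose_nth edge_op_nth[OF pt] v
    proof (intro sum.cong refl)
      fix m s
      show "(if b i' = b i then t $ (s, m) $ (i', j') * adj (graph_of_edges b E) (munit i s) $ j $ m / block_dim b i' else 0)
        = P $ (i,j) $ (s,m) * t $ (s,m) $ (i',j')" 
      proof (cases "b i' = b s \<and> b i = b s")
        case True
        then have "block_dim b i' = block_dim b i" by (simp add: block_dim_def)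
        with True A[of i s j m] block_dim_nonzero[of b i] show ?thesis by simp
      next
        case False
        have "P $ (i,j) $ (s,m) = 0" if "b i \<noteq> b s"
          using that Pq by (simp add: qalg_def)
        moreover have "t $ (s,m) $ (i',j') = 0" if "b i' \<noteq> b s"
          using that t by (auto simp: qalg_def)
        ultimately show ?thesis using False by auto
      qed
    qed
    also have "\<dots> = (P ** t) $ (i,j) $ (i',j')"
      unfolding matrix_matrix_mult_def by (simp add: sum_UNIV_prod) (rule sum.swap)
    finally show ?thesis .
  qed
  then show ?thesis by (simp add: EP[OF t] vec_eq_iff)
qed


section \<open>Complements, independent sets and cliques\<close>

definition graph_compl :: "('h::finite, 'k) qgraph \<Rightarrow> ('h, 'k) qgraph" where
  "graph_compl G =
     graph_of_edges (verts G) (ps_diff (ps_compl (edges G)) (diagonal (verts G)))"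

definition independent_set :: "('h::finite, 'k) qgraph \<Rightarrow> ('h opr \<Rightarrow> 'h opr) \<Rightarrow> bool" where
  "independent_set G X \<longleftrightarrow>
     projective_subset (verts G) X \<and> ps_disjoint (ps_times X X) (edges G)"

definition clique :: "('h::finite, 'k) qgraph \<Rightarrow> ('h opr \<Rightarrow> 'h opr) \<Rightarrow> bool" where
  "clique K X \<longleftrightarrow>
     projective_subset (verts K) X \<and>
     ps_le (ps_times X X) (ps_union (edges K) (diagonal (verts K)))"

end

theory Submission
  imports Defs
begin

text \<open>
  Write P for the projection of the edge relation E and Q for that of the diagonal.  Being an
  independent set says that the image of \<open>X \<times> X\<close> is orthogonal to the range of P.  Since P is
  self-adjoint, this means that the image lies in the kernel of P, that is, in the range of
  1 - P (\<open>ps_disjoint_iff_ps_le_compl\<close>).  Being a clique of the complement says that the image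
  lies in the span of the ranges of the projector of \<open>E\<^sup>c \<setminus> \<Delta>\<close> and of Q.  So it is
  enough that this span is the range of 1 - P (\<open>reflexive_edges_compl\<close>).

  Subspace lattices are not distributive, and this is where looplessness enters: PQ = 0
  (\<open>loopless_imp_edges_diag_orthogonal\<close>), so P and Q commute, the projector of
  \<open>E\<^sup>c \<setminus> \<Delta>\<close> is 1 - P - Q, and adding Q back gives 1 - P.

  The facts about P and Q are read off from matrix entries.  The entries of P are those of the
  images of matrix units under the adjacency operator, divided by the block size
  (\<open>projection_edges_nth\<close>), and Q averages over the pairs (k, k) with k in one block.  In these
  coordinates the axioms of a quantum graph make P an orthogonal projection, and the entries of
  \<open>m(A \<otimes> id)m\<^sup>*\<close> give those of PQ.  Moreover P and Q have their entries inside the blocks of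
  \<open>V\<^sup>o\<^sup>p \<otimes> V\<close>.  Hence so does 1 - P - Q, which therefore belongs to a projective subset, and the
  complement graph has that subset as its edge relation.
\<close>

section \<open>Orthogonal projectors on a finite-dimensional Hilbert space\<close>

lemma matrix_add_rdistrib: "(A + B) ** C = A ** C + B ** C"
  by (simp add: vec_eq_iff matrix_matrix_mult_def distrib_right sum.distrib)

lemma matrix_diff_ldistrib:
  fixes A :: "'a::ring_1^'n^'m"
  shows "A ** (B - C) = A ** B - A ** C"
  by (simp add: vec_eq_iff matrix_matrix_mult_def right_diff_distrib sum_subtractf)

lemma matrix_diff_rdistrib:
  fixes C :: "'a::ring_1^'n^'m"
  shows "(A - B) ** C = A ** C - B ** C"
  by (simp add: vec_eq_iff matrix_matrix_mult_def left_diff_distrib sum_subtractf)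

lemma mstar_nth: "mstar a $ i $ j = cnj (a $ j $ i)"
  by (simp add: mstar_def transpose_def)

lemma mstar_mult: "mstar (a ** c) = mstar c ** mstar a"
  by (simp add: vec_eq_iff mstar_nth matrix_matrix_mult_def mult.commute)

lemma mstar_add: "mstar (a + c) = mstar a + mstar c"
  by (simp add: vec_eq_iff mstar_nth)

lemma mstar_diff: "mstar (a - c) = mstar a - mstar c"
  by (simp add: vec_eq_iff mstar_nth)

lemma mstar_one: "mstar (mat 1) = mat 1"
  by (simp add: vec_eq_iff mstar_nth mat_def)

lemma mstar_munit: "mstar (munit i j) = munit j i"
  by (simp add: vec_eq_iff mstar_nth munit_def)

lemma cinner_mstar: "cinner u (a *v v) = cinner (mstar a *v u) v"
proof -
  have "cinner u (a *v v) = (\<Sum>i\<in>UNIV. \<Sum>j\<in>UNIV. cnj (u $ i) * a $ i $ j * v $ j)"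
    by (simp add: cinner_def matrix_vector_mult_def sum_distrib_left mult.assoc)
  also have "\<dots> = (\<Sum>j\<in>UNIV. \<Sum>i\<in>UNIV. cnj (u $ i) * a $ i $ j * v $ j)"
    by (rule sum.swap)
  also have "\<dots> = cinner (mstar a *v u) v"
    by (simp add: cinner_def matrix_vector_mult_def mstar_nth sum_distrib_left mult_ac)
  finally show ?thesis .
qed

lemma cinner_nondegenerate:
  assumes "\<And>v. cinner u v = 0"
  shows "u = 0"
proof -
  have "cnj (u $ i) = cinner u (axis i 1)" for i
    by (simp add: cinner_def axis_def if_distrib cong: if_cong)
  with assms show ?thesis
    by (simp add: vec_eq_iff)
qed

definition projector :: "'h::finite opr \<Rightarrow> bool" where
  "projector P \<longleftrightarrow> P ** P = P \<and> mstar P = P"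

lemma range_idempotent_iff:
  assumes "P ** P = P"
  shows "v \<in> range ((*v) P) \<longleftrightarrow> P *v v = v"
proof
  assume "v \<in> range ((*v) P)"
  then show "P *v v = v"
    using assms by (auto simp: matrix_vector_mul_assoc)
next
  assume "P *v v = v"
  then show "v \<in> range ((*v) P)"
    by (metis rangeI)
qed

text \<open>
  If P and Q have the same range, each fixes the range of the other, so PQ = Q and QP = P;
  taking adjoints of the first identity gives QP = Q.
\<close>

lemma projector_unique:
  assumes "projector P" "projector Q" "range ((*v) P) = range ((*v) Q)"
  shows "P = Q"
proof -
  have absorb: "R ** S = S"
    if "projector R" "range ((*v) R) = range ((*v) S)" for R S :: "'a opr"
  proof -
    have "R *v (S *v v) = S *v v" for v
      using that range_idempotent_iff[of R "S *v v"] by (auto simp: projector_def)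
    then show ?thesis
      by (simp add: matrix_eq matrix_vector_mul_assoc)
  qed
  have "Q = mstar (P ** Q)"
    using absorb[of P Q] assms by (simp add: projector_def)
  also have "\<dots> = Q ** P"
    using assms by (simp add: mstar_mult projector_def)
  also have "\<dots> = P"
    using absorb[of Q P] assms by simp
  finally show ?thesis by simp
qed

lemma projector_onto_eq:
  assumes "projector P" "range ((*v) P) = S"
  shows "projector_onto S = P"
  unfolding projector_onto_def
proof (rule the_equality)
  show "P ** P = P \<and> mstar P = P \<and> range ((*v) P) = S"
    using assms by (simp add: projector_def)
  show "Q = P" if "Q ** Q = Q \<and> mstar Q = Q \<and> range ((*v) Q) = S" for Q
    using that assms projector_unique[of Q P] by (simp add: projector_def)
qed

lemma projector_compl:
  assumes "projector P"
  shows "projector (mat 1 - P)"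
  using assms
  by (simp add: projector_def mstar_diff mstar_one matrix_diff_ldistrib matrix_diff_rdistrib)

lemma range_compl_iff:
  assumes "projector P"
  shows "v \<in> range ((*v) (mat 1 - P)) \<longleftrightarrow> P *v v = 0"
  using range_idempotent_iff[of "mat 1 - P" v] projector_compl[OF assms]
  by (simp add: projector_def matrix_vector_mult_diff_rdistrib)

lemma orthogonal_projectors_commute:
  assumes "projector P" "projector Q" "P ** Q = 0"
  shows "Q ** P = 0"
proof -
  have "Q ** P = mstar (P ** Q)"
    using assms(1,2) by (simp add: mstar_mult projector_def)
  also have "\<dots> = 0"
    using assms(3) by simp (simp add: vec_eq_iff mstar_nth)
  finally show ?thesis .
qed

lemma projector_add:
  assumes "projector P" "projector Q" "P ** Q = 0"
  shows "projector (P + Q)"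
  using assms orthogonal_projectors_commute[OF assms]
  by (simp add: projector_def mstar_add matrix_add_ldistrib matrix_add_rdistrib)

lemma range_add_orthogonal:
  assumes "projector P" "projector Q" "P ** Q = 0"
  shows "range ((*v) (P + Q)) = vec.span (range ((*v) P) \<union> range ((*v) Q))"
proof
  have QP: "Q ** P = 0"
    using assms by (rule orthogonal_projectors_commute)
  show "range ((*v) (P + Q)) \<subseteq> vec.span (range ((*v) P) \<union> range ((*v) Q))"
  proof (rule image_subsetI)
    fix v
    have "P *v v + Q *v v \<in> vec.span (range ((*v) P) \<union> range ((*v) Q))"
      by (intro vec.span_add vec.span_base) auto
    then show "(P + Q) *v v \<in> vec.span (range ((*v) P) \<union> range ((*v) Q))"
      by (simp add: matrix_vector_mult_add_rdistrib)
  qed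
  have idem: "(P + Q) ** (P + Q) = P + Q"
    using projector_add[OF assms] by (simp add: projector_def)
  have "(P + Q) *v (P *v v) = P *v v" "(P + Q) *v (Q *v v) = Q *v v" for v
    using assms QP by (simp_all add: projector_def matrix_vector_mul_assoc matrix_add_rdistrib)
  then have "range ((*v) P) \<union> range ((*v) Q) \<subseteq> range ((*v) (P + Q))"
    using range_idempotent_iff[OF idem] by auto
  moreover have "vec.subspace (range ((*v) (P + Q)))"
    using vec.linear_subspace_image[OF matrix_vector_mul_linear_gen vec.subspace_UNIV] .
  ultimately show "vec.span (range ((*v) P) \<union> range ((*v) Q)) \<subseteq> range ((*v) (P + Q))"
    by (rule vec.span_minimal)
qed

text \<open>
  Multiplying (P + Q)v = 0 by P and by Q shows that the kernel of P + Q is the intersection of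
  the kernels, and the kernel of a projector is the range of its complement.
\<close>

lemma range_compl_inter:
  assumes "projector P" "projector Q" "P ** Q = 0"
  shows "range ((*v) (mat 1 - (P + Q))) = range ((*v) (mat 1 - P)) \<inter> range ((*v) (mat 1 - Q))"
proof -
  have QP: "Q ** P = 0"
    using assms by (rule orthogonal_projectors_commute)
  have "(P + Q) *v v = 0 \<longleftrightarrow> P *v v = 0 \<and> Q *v v = 0" for v
  proof
    assume z: "(P + Q) *v v = 0"
    have "P *v v = P *v ((P + Q) *v v)" "Q *v v = Q *v ((P + Q) *v v)"
      using assms QP by (simp_all add: projector_def matrix_vector_mul_assoc matrix_add_ldistrib)
    with z show "P *v v = 0 \<and> Q *v v = 0"
      by simp
  qed (simp add: matrix_vector_mult_add_rdistrib)
  then show ?thesis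
    using range_compl_iff[OF projector_add[OF assms]] assms range_compl_iff
    by blast
qed

section \<open>Projective subsets from projections in the algebra\<close>

lemma projection_of_projection: "projection (of_projection P) = P"
  by (simp add: projection_def of_projection_def)

lemma one_in_qalg: "mat 1 \<in> qalg b"
  by (auto simp: qalg_def mat_def)

lemma munit_in_qalg: "b i = b j \<Longrightarrow> munit i j \<in> qalg b"
  by (auto simp: qalg_def munit_def)

lemma qalg_mult:
  assumes "x \<in> qalg b" "y \<in> qalg b"
  shows "x ** y \<in> qalg b"
proof -
  have "x $ i $ k * y $ k $ j = 0" if "b i \<noteq> b j" for i j k
    using assms that unfolding qalg_def by (metis (mono_tags, lifting) mem_Collect_eq mult_eq_0_iff)
  then show ?thesis
    unfolding qalg_def matrix_matrix_mult_def by (auto intro!: sum.neutral simp del: mult_eq_0_iff)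
qed

lemma projective_subset_of_projection:
  assumes "projector P" "P \<in> qalg b"
  shows "projective_subset b (of_projection P)"
proof -
  have "P ** cscale c x = cscale c (P ** x)" for c x
    by (simp add: vec_eq_iff cscale_def matrix_matrix_mult_def sum_distrib_left mult.left_commute)
  then have "linear_between (qalg b) (qalg b) (of_projection P)"
    using assms by (simp add: linear_between_def of_projection_def qalg_mult matrix_add_ldistrib)
  moreover have "mstar (P ** x) ** y = mstar x ** (P ** y)" for x y :: "'a opr"
    using assms by (simp add: mstar_mult projector_def matrix_mul_assoc)
  moreover have "P ** (P ** x) = P ** x" for x :: "'a opr"
    using assms by (simp add: matrix_mul_assoc projector_def)
  ultimately show ?thesis
    unfolding projective_subset_def of_projection_def qinner_def
    by (simp only: matrix_mul_assoc) blast
qed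

text \<open>
  The kernel of a self-adjoint operator is the orthogonal complement of its range; for the
  projection of E, that kernel is the image of the complement of E.
\<close>

lemma ps_disjoint_iff_ps_le_compl:
  assumes "projector (projection E)"
  shows "ps_disjoint Y E \<longleftrightarrow> ps_le Y (ps_compl E)"
proof -
  have "(\<forall>v. cinner u (projection E *v v) = 0) \<longleftrightarrow> projection E *v u = 0" for u
  proof
    assume "\<forall>v. cinner u (projection E *v v) = 0"
    then show "projection E *v u = 0"
      using assms by (intro cinner_nondegenerate) (simp add: cinner_mstar projector_def)
  next
    assume "projection E *v u = 0"
    then show "\<forall>v. cinner u (projection E *v v) = 0"
      using assms by (simp add: cinner_mstar projector_def) (simp add: cinner_def)
  qed
  then have "ps_disjoint Y E \<longleftrightarrow> (\<forall>u\<in>img Y. projection E *v u = 0)"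
    by (simp add: ps_disjoint_def img_def)
  also have "\<dots> \<longleftrightarrow> img Y \<subseteq> range ((*v) (mat 1 - projection E))"
    by (simp only: subset_iff range_compl_iff[OF assms] Ball_def)
  finally show ?thesis
    by (simp add: ps_le_def img_def ps_compl_def projection_of_projection)
qed


section \<open>The projection of the diagonal\<close>

text \<open>
  The commutant consists of the operators that are scalar on each block, so the vectors of the
  diagonal are supported on the pairs (i, i) and constant along each block.  Averaging over
  these pairs is the orthogonal projection onto them.
\<close>

definition diag_proj :: "('h::finite \<Rightarrow> 'k) \<Rightarrow> ('h \<times> 'h) opr" where
  "diag_proj b = (\<chi> p q. if fst p = snd p \<and> fst q = snd q \<and> b (fst p) = b (fst q)
     then 1 / block_dim b (fst p) else 0)"

lemma diag_proj_nth:
  "diag_proj b $ (i, j) $ (i', j') =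
     (if i = j \<and> i' = j' \<and> b i = b i' then 1 / block_dim b i else 0)"
  unfolding diag_proj_def by auto

lemma sum_over_block: "(\<Sum>k\<in>UNIV. if b i = b k then c else 0) = block_dim b i * (c::complex)"
proof -
  have "{k. b i = b k} = b -` {b i}"
    by auto
  then show ?thesis
    by (simp add: block_dim_def sum.If_cases)
qed

lemma diag_proj_vec:
  "(diag_proj b *v v) $ (i, j) =
     (if i = j then (\<Sum>k\<in>UNIV. if b i = b k then v $ (k, k) else 0) / block_dim b i else 0)"
proof -
  have "(diag_proj b *v v) $ (i, j) = (\<Sum>k\<in>UNIV. \<Sum>l\<in>UNIV.
      if l = k then if i = j \<and> b i = b k then v $ (k, l) / block_dim b i else 0 else 0)"
    unfolding matrix_vector_mult_def vec_lambda_beta sum_UNIV_prod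
    by (intro sum.cong refl) (auto simp: diag_proj_nth)
  also have "\<dots> = (\<Sum>k\<in>UNIV. if i = j \<and> b i = b k then v $ (k, k) / block_dim b i else 0)"
    by simp
  also have "\<dots> = (if i = j then (\<Sum>k\<in>UNIV. if b i = b k then v $ (k, k) else 0) / block_dim b i
      else 0)"
    by (auto simp: sum_divide_distrib intro!: sum.cong)
  finally show ?thesis .
qed

text \<open>
  Commuting with the diagonal units makes x diagonal; commuting with the off-diagonal units of a
  block makes its diagonal entries there equal.
\<close>

lemma commutant_iff:
  fixes b :: "'h::finite \<Rightarrow> 'k"
  shows "x \<in> commutant b \<longleftrightarrow>
     (\<forall>i j. i \<noteq> j \<longrightarrow> x $ i $ j = 0) \<and> (\<forall>i j. b i = b j \<longrightarrow> x $ i $ i = x $ j $ j)"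
proof
  assume x: "x \<in> commutant b"
  have left: "(x ** munit k l) $ i $ j = (if j = l then x $ i $ k else 0)" for k l i j
    by (simp add: matrix_matrix_mult_def munit_nth mult_if_zero sum_if_const cong: if_cong)
  have right: "(munit k l ** x) $ i $ j = (if i = k then x $ l $ j else 0)" for k l i j
    by (simp add: matrix_matrix_mult_def munit_nth mult_if_zero sum_if_const cong: if_cong)
  have comm: "(if j = l then x $ i $ k else 0) = (if i = k then x $ l $ j else 0)"
    if "b k = b l" for i j k l
    using x munit_in_qalg[OF that] left[of k l i j] right[of k l i j]
    by (simp add: commutant_def)
  show "(\<forall>i j. i \<noteq> j \<longrightarrow> x $ i $ j = 0) \<and> (\<forall>i j. b i = b j \<longrightarrow> x $ i $ i = x $ j $ j)"
  proof (intro conjI allI impI)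
    fix i j :: 'h assume "i \<noteq> j"
    with comm[of j j j i] show "x $ i $ j = 0" by simp
  next
    fix i j :: 'h assume "b i = b j"
    with comm[of i j j i] show "x $ i $ i = x $ j $ j" by simp
  qed
next
  assume x: "(\<forall>i j. i \<noteq> j \<longrightarrow> x $ i $ j = 0) \<and> (\<forall>i j. b i = b j \<longrightarrow> x $ i $ i = x $ j $ j)"
  have entry: "x $ i $ j = (if j = i then x $ i $ i else 0)" for i j
    using x by (metis (no_types))
  have "(x ** a) $ i $ j = (a ** x) $ i $ j" if a: "a \<in> qalg b" for a i j
  proof -
    have "(x ** a) $ i $ j = (\<Sum>k\<in>UNIV. if k = i then x $ i $ i * a $ i $ j else 0)"
      unfolding matrix_matrix_mult_def vec_lambda_beta
      by (intro sum.cong refl) (subst entry, simp)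
    also have "\<dots> = x $ i $ i * a $ i $ j"
      by simp
    also have "\<dots> = x $ j $ j * a $ i $ j"
    proof (cases "b i = b j")
      case True
      then have "x $ i $ i = x $ j $ j" using x by blast
      then show ?thesis by simp
    qed (use a in \<open>simp add: qalg_def\<close>)
    also have "\<dots> = (\<Sum>k\<in>UNIV. if k = j then x $ j $ j * a $ i $ j else 0)"
      by simp
    also have "\<dots> = (a ** x) $ i $ j"
      unfolding matrix_matrix_mult_def vec_lambda_beta
      by (intro sum.cong refl) (subst entry[of _ j], auto)
    finally show ?thesis .
  qed
  then show "x \<in> commutant b"
    by (simp add: commutant_def vec_eq_iff)
qed

lemma mstar_diag_proj: "mstar (diag_proj b) = diag_proj b"
  by (auto simp: vec_eq_iff mstar_nth diag_proj_nth block_dim_def)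

lemma diag_proj_fixes_commutant:
  assumes "x \<in> commutant b"
  shows "diag_proj b *v vec_of_op x = vec_of_op x"
proof -
  have x: "\<forall>i j. i \<noteq> j \<longrightarrow> x $ i $ j = 0" "\<forall>i j. b i = b j \<longrightarrow> x $ i $ i = x $ j $ j"
    using iffD1[OF commutant_iff assms] by blast+
  have diag: "x $ k $ k = x $ i $ i" if "b i = b k" for i k
    using that by (rule x(2)[rule_format, symmetric])
  have off: "x $ j $ i = 0" if "j \<noteq> i" for i j
    using that by (rule x(1)[rule_format])
  have "(diag_proj b *v vec_of_op x) $ (i, j) = vec_of_op x $ (i, j)" for i j
  proof (cases "i = j")
    case True
    have "(\<Sum>k\<in>UNIV. if b i = b k then vec_of_op x $ (k, k) else 0)
        = (\<Sum>k\<in>UNIV. if b i = b k then x $ i $ i else 0)"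
      by (intro sum.cong refl if_cong) (simp add: vec_of_op_def, rule diag)
    also have "\<dots> / block_dim b i = vec_of_op x $ (i, j)"
      using True by (simp add: sum_over_block block_dim_nonzero vec_of_op_def)
    finally show ?thesis
      using True by (simp add: diag_proj_vec)
  next
    case False
    then show ?thesis
      by (simp add: diag_proj_vec off vec_of_op_def)
  qed
  then show ?thesis
    by (simp add: vec_eq_iff)
qed

lemma diag_proj_vec_in_commutant: "op_of_vec (diag_proj b *v v) \<in> commutant b"
  by (auto simp: commutant_iff op_of_vec_def diag_proj_vec block_dim_def)

lemma vec_of_op_of_vec: "vec_of_op (op_of_vec v) = v"
  by (simp add: vec_eq_iff vec_of_op_def op_of_vec_def)

lemma range_diag_proj: "range ((*v) (diag_proj b)) = vec_of_op ` commutant b"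
proof
  show "range ((*v) (diag_proj b)) \<subseteq> vec_of_op ` commutant b"
    by (metis diag_proj_vec_in_commutant image_eqI image_subsetI vec_of_op_of_vec)
  show "vec_of_op ` commutant b \<subseteq> range ((*v) (diag_proj b))"
    by (metis diag_proj_fixes_commutant image_subsetI rangeI)
qed

lemma projector_diag_proj: "projector (diag_proj b)"
proof -
  have "diag_proj b *v (diag_proj b *v v) = diag_proj b *v v" for v
    by (metis diag_proj_fixes_commutant diag_proj_vec_in_commutant vec_of_op_of_vec)
  then have "diag_proj b ** diag_proj b = diag_proj b"
    by (simp add: matrix_eq matrix_vector_mul_assoc)
  then show ?thesis
    by (simp add: projector_def mstar_diag_proj)
qed

lemma diag_proj_in_qalg: "diag_proj b \<in> qalg (map_prod b b)"
  by (auto simp: qalg_def diag_proj_nth)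

lemma projection_diagonal: "projection (diagonal b) = diag_proj b"
  using projector_onto_eq[OF projector_diag_proj range_diag_proj]
  by (simp add: diagonal_def projection_of_projection)


section \<open>The projection of the edge relation\<close>

lemma projection_edges_nth:
  "projection (edges G) $ (i, j) $ (i', j') =
     (if verts G i = verts G i' then adj G (munit i i') $ j $ j' / block_dim (verts G) i else 0)"
proof -
  have "ptranspose (mat 1) \<in> qalg (map_prod (verts G) (verts G))"
    by (auto simp: qalg_map_prod_iff ptranspose_nth mat_def)
  note edge_op_nth[OF this, of i' j i j']
  also have "(\<Sum>m\<in>UNIV. \<Sum>s\<in>UNIV. if verts G i' = verts G i
        then ptranspose (mat 1) $ (i', m) $ (s, j') * adj G (munit i s) $ j $ m / block_dim (verts G) i'
        else 0)
      = (\<Sum>m\<in>UNIV. \<Sum>s\<in>UNIV. if s = i' then if m = j' then if verts G i' = verts G i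
        then adj G (munit i i') $ j $ j' / block_dim (verts G) i' else 0 else 0 else 0)"
    by (intro sum.cong refl) (auto simp: ptranspose_nth mat_def)
  also have "\<dots> = (if verts G i = verts G i'
      then adj G (munit i i') $ j $ j' / block_dim (verts G) i else 0)"
    by (auto simp: block_dim_def)
  finally show ?thesis
    by (simp add: projection_def edges_def ptranspose_nth)
qed

text \<open>
  The comultiplication splits a matrix unit through every intermediate index of its block, with
  the normalisation that makes it a section of the multiplication.
\<close>

lemma qmult_tensor_qcomult_munit:
  assumes "b i = b i'"
  shows "qmult (tensor_map f g (qcomult b (munit i i'))) $ j $ j' =
    (\<Sum>k\<in>UNIV. if b i = b k then (f (munit i k) ** g (munit k i')) $ j $ j' else 0) / block_dim b i"
proof -
  \<comment> \<open>nested conditionals, each on one summation variable, so that the sums collapse one by one\<close>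
  have com: "qcomult b (munit i i') $ (p, q) $ (p', q') =
      (if p = i then if q' = i' then if p' = q then if b i = b q then 1 / block_dim b i
        else 0 else 0 else 0 else 0)" for p q p' q'
    using qcomult_nth[OF munit_in_qalg[OF assms]] by (simp add: munit_nth)
  have "tensor_map f g (qcomult b (munit i i')) $ (j, l) $ (l, j') =
      (\<Sum>k\<in>UNIV. if b i = b k then f (munit i k) $ j $ l * g (munit k i') $ l $ j' / block_dim b i
        else 0)" for l
    unfolding tensor_map_nth com mult_if_zero sum_if_const by (simp cong: if_cong)
  then have "qmult (tensor_map f g (qcomult b (munit i i'))) $ j $ j' =
      (\<Sum>l\<in>UNIV. \<Sum>k\<in>UNIV. if b i = b k
        then f (munit i k) $ j $ l * g (munit k i') $ l $ j' / block_dim b i else 0)"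
    by (simp add: qmult_nth)
  also have "\<dots> = (\<Sum>k\<in>UNIV. \<Sum>l\<in>UNIV. if b i = b k
        then f (munit i k) $ j $ l * g (munit k i') $ l $ j' / block_dim b i else 0)"
    by (rule sum.swap)
  also have "\<dots> = (\<Sum>k\<in>UNIV. (if b i = b k then (f (munit i k) ** g (munit k i')) $ j $ j' else 0)
      / block_dim b i)"
    by (intro sum.cong refl) (auto simp: matrix_matrix_mult_def sum_divide_distrib)
  finally show ?thesis
    by (simp add: sum_divide_distrib)
qed

text \<open>
  The blocks of the edge projection are, up to the block size, the images of matrix units under
  the adjacency operator.  In this form the Schur idempotence of the adjacency operator is the
  idempotence of the projection, and its compatibility with the involution is self-adjointness.
\<close>

lemma projector_projection_edges:
  assumes "quantum_graph G"
  shows "projector (projection (edges G))"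
proof -
  let ?b = "verts G" and ?P = "projection (edges G)" and ?A = "\<lambda>i j. adj G (munit i j)"
  have schur: "(\<Sum>k\<in>UNIV. if ?b i = ?b k then (?A i k ** ?A k i') $ j $ j' else 0)
      = block_dim ?b i * ?A i i' $ j $ j'" if "?b i = ?b i'" for i i' j j'
    using assms munit_in_qalg[OF that] qmult_tensor_qcomult_munit[OF that, of "adj G" "adj G" j j']
      block_dim_nonzero[of ?b i]
    by (simp add: quantum_graph_def field_simps)
  have "(?P ** ?P) $ (i, j) $ (i', j') = ?P $ (i, j) $ (i', j')" for i j i' j'
  proof (cases "?b i = ?b i'")
    case True
    have "(?P ** ?P) $ (i, j) $ (i', j') =
        (\<Sum>k\<in>UNIV. \<Sum>l\<in>UNIV. ?P $ (i, j) $ (k, l) * ?P $ (k, l) $ (i', j'))"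
      by (simp add: matrix_matrix_mult_def sum_UNIV_prod)
    also have "\<dots> = (\<Sum>k\<in>UNIV. (if ?b i = ?b k then (?A i k ** ?A k i') $ j $ j' else 0)
        / (block_dim ?b i * block_dim ?b i))"
    proof (rule sum.cong[OF refl])
      fix k
      show "(\<Sum>l\<in>UNIV. ?P $ (i, j) $ (k, l) * ?P $ (k, l) $ (i', j')) =
          (if ?b i = ?b k then (?A i k ** ?A k i') $ j $ j' else 0)
            / (block_dim ?b i * block_dim ?b i)"
        using True
        by (auto simp: projection_edges_nth matrix_matrix_mult_def sum_divide_distrib block_dim_def)
    qed
    also have "\<dots> = ?A i i' $ j $ j' / block_dim ?b i"
      using schur[OF True] block_dim_nonzero[of ?b i] by (simp add: sum_divide_distrib[symmetric])
    finally show ?thesis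
      using True by (simp add: projection_edges_nth)
  next
    case False
    then have "?P $ (i, j) $ (k, l) * ?P $ (k, l) $ (i', j') = 0" for k l
      by (auto simp: projection_edges_nth)
    then have "(?P ** ?P) $ (i, j) $ (i', j') = 0"
      by (simp only: matrix_matrix_mult_def vec_lambda_beta sum_UNIV_prod sum.neutral_const)
    with False show ?thesis
      by (simp add: projection_edges_nth)
  qed
  moreover have "mstar ?P $ (i, j) $ (i', j') = ?P $ (i, j) $ (i', j')" for i j i' j'
  proof (cases "?b i = ?b i'")
    case True
    then have "?A i i' = mstar (?A i' i)"
      using assms munit_in_qalg[of ?b i' i] by (metis mstar_munit quantum_graph_def)
    with True show ?thesis
      by (simp add: mstar_nth projection_edges_nth block_dim_def)
  qed (simp add: mstar_nth projection_edges_nth)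
  ultimately show ?thesis
    by (simp add: projector_def vec_eq_iff)
qed

lemma projection_edges_in_qalg:
  assumes "quantum_graph G"
  shows "projection (edges G) \<in> qalg (map_prod (verts G) (verts G))"
proof -
  have "adj G (munit i i') \<in> qalg (verts G)" if "verts G i = verts G i'" for i i'
    using assms munit_in_qalg[of "verts G", OF that]
    by (simp add: quantum_graph_def linear_between_def)
  then show ?thesis
    by (auto simp: qalg_map_prod_iff projection_edges_nth) (auto simp: qalg_def)
qed

text \<open>
  Applying the edge projection to a vector of the diagonal sums its columns over the pairs
  (k, k) of one block, and these sums are the entries of \<open>m(A \<otimes> id)m\<^sup>*\<close> at a matrix unit.
\<close>

lemma loopless_imp_edges_diag_orthogonal:
  assumes "loopless G"
  shows "projection (edges G) ** diag_proj (verts G) = 0"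
proof -
  let ?b = "verts G" and ?P = "projection (edges G)" and ?A = "\<lambda>i j. adj G (munit i j)"
  have loop: "(\<Sum>k\<in>UNIV. if ?b i = ?b k then ?A i k $ j $ k else 0) = 0" for i j
  proof -
    have "(?A i k ** munit k i) $ j $ i = ?A i k $ j $ k" for k
      by (simp add: matrix_matrix_mult_def munit_nth mult_if_zero cong: if_cong)
    then show ?thesis
      using qmult_tensor_qcomult_munit[of ?b i i "adj G" id j i] assms munit_in_qalg[of ?b i i]
        block_dim_nonzero[of ?b i]
      by (simp add: loopless_def cong: if_cong)
  qed
  have "(?P ** diag_proj ?b) $ (i, j) $ (i', j') = 0" for i j i' j'
  proof -
    have "(?P ** diag_proj ?b) $ (i, j) $ (i', j') = (\<Sum>k\<in>UNIV. \<Sum>l\<in>UNIV.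
        if l = k then if i' = j' \<and> ?b i = ?b i' then
          (if ?b i = ?b k then ?A i k $ j $ k else 0) / (block_dim ?b i * block_dim ?b i)
        else 0 else 0)"
      unfolding matrix_matrix_mult_def vec_lambda_beta sum_UNIV_prod
      by (intro sum.cong refl) (auto simp: projection_edges_nth diag_proj_nth block_dim_def)
    also have "\<dots> = (if i' = j' \<and> ?b i = ?b i' then
        (\<Sum>k\<in>UNIV. if ?b i = ?b k then ?A i k $ j $ k else 0) / (block_dim ?b i * block_dim ?b i)
        else 0)"
      by (cases "i' = j' \<and> ?b i = ?b i'")
        (simp_all only: simp_thms if_True if_False sum.delta finite UNIV_I sum.neutral_const
          sum_divide_distrib)
    also have "\<dots> = 0"
      unfolding loop by simp
    finally show ?thesis .
  qed
  then show ?thesis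
    by (simp add: vec_eq_iff)
qed


section \<open>The complement graph\<close>

lemma projection_edges_compl:
  assumes "quantum_graph G" "loopless G"
  shows "projection (edges (graph_compl G)) =
    mat 1 - (projection (edges G) + diag_proj (verts G))"
proof -
  let ?b = "verts G" and ?P = "projection (edges G)" and ?Q = "diag_proj (verts G)"
  let ?R = "mat 1 - (?P + ?Q)" and ?D = "ps_diff (ps_compl (edges G)) (diagonal (verts G))"
  note orth = projector_projection_edges[OF assms(1)] projector_diag_proj[of "verts G"]
    loopless_imp_edges_diag_orthogonal[OF assms(2)]
  have R: "projector ?R"
    using orth by (intro projector_compl projector_add)
  have D: "?D = of_projection ?R"
    using projector_onto_eq[OF R range_compl_inter[OF orth]]
    by (simp add: ps_diff_def ps_inter_def ps_compl_def img_def projection_of_projection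
        projection_diagonal)
  have "?R \<in> qalg (map_prod ?b ?b)"
    using one_in_qalg[of "map_prod ?b ?b"] projection_edges_in_qalg[OF assms(1)]
      diag_proj_in_qalg[of ?b]
    by (simp add: qalg_def)
  then have "projective_subset (map_prod ?b ?b) ?D"
    unfolding D using R by (intro projective_subset_of_projection)
  then have "projection (edges (graph_compl G)) = projection ?D"
    by (simp add: projection_def graph_compl_def edges_graph_of_edges one_in_qalg)
  then show ?thesis
    by (simp add: D projection_of_projection)
qed

text \<open>
  Removing the diagonal from the complement of the edges and adding it back changes nothing,
  because a loopless graph has its diagonal inside that complement.
\<close>

lemma reflexive_edges_compl:
  assumes "quantum_graph G" "loopless G"
  shows "img (ps_union (edges (graph_compl G)) (diagonal (verts G))) = img (ps_compl (edges G))"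
proof -
  let ?P = "projection (edges G)" and ?Q = "diag_proj (verts G)"
  let ?R = "mat 1 - (?P + ?Q)"
  note orth = projector_projection_edges[OF assms(1)] projector_diag_proj[of "verts G"]
    loopless_imp_edges_diag_orthogonal[OF assms(2)]
  have R: "projector ?R"
    using orth by (intro projector_compl projector_add)
  have RQ: "?R ** ?Q = 0"
    using orth by (simp add: projector_def matrix_diff_rdistrib matrix_add_rdistrib)
  have sum: "?R + ?Q = mat 1 - ?P"
    by simp
  have "projector_onto (vec.span (range ((*v) ?R) \<union> range ((*v) ?Q))) = mat 1 - ?P"
    using projector_onto_eq[OF projector_add[OF R projector_diag_proj RQ]
        range_add_orthogonal[OF R projector_diag_proj RQ]]
    by (simp only: sum)
  then show ?thesis
    by (simp add: ps_union_def ps_compl_def img_def projection_of_projection projection_diagonal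
        projection_edges_compl[OF assms])
qed

theorem proposition4p28:
  fixes G :: "('h::finite, 'k) qgraph"
    and X :: "'h opr \<Rightarrow> 'h opr"
  assumes "quantum_graph G"
    and "undirected G"
    and "loopless G"
    and "projective_subset (verts G) X"
  shows "independent_set G X \<longleftrightarrow> clique (graph_compl G) X"
proof -
  have verts: "verts (graph_compl G) = verts G"
    by (simp add: graph_compl_def graph_of_edges_def)
  have "ps_disjoint (ps_times X X) (edges G) \<longleftrightarrow> ps_le (ps_times X X) (ps_compl (edges G))"
    using projector_projection_edges[OF assms(1)] by (rule ps_disjoint_iff_ps_le_compl)
  also have "\<dots> \<longleftrightarrow>
      ps_le (ps_times X X) (ps_union (edges (graph_compl G)) (diagonal (verts G)))"
    by (simp add: ps_le_def reflexive_edges_compl[OF assms(1,3)])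
  finally show ?thesis
    by (simp add: independent_set_def clique_def verts)
qed

end
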